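(* Let $L$ be a geometric lattice. Then for any positive integer $k$, we have $$\sum_{\substack{x\in L\\ r(x)\le 2k}}\mu(\hat 0,x)\;\ge\;0\qquad\text{and}\qquad \sum_{\substack{x\in L\\ r(x)\le 2k-1}}\mu(\hat 0,x)\;\le\;0 .$$ Here $\mu$ denotes the Möbius function on $L$ and $r$ denotes a rank function on $L$.
   Context: A lattice is a partially ordered set in which any two elements $x,y$ have a least upper bound (join) $x\vee y$ and a greatest lower bound (meet) $x\wedge y$. For a finite lattice $L$, $\hat 0$ denotes its least element. For $x\le z$ in $L$, $[x,z]=\{y\in L: x\le y\le z\}$. An atom is an element $x\ne\hat 0$ of $L$ such that no $y\in L$ satisfies $\hat 0<y<x$. $L$ is atomistic if every element other than $\hat 0$ is a join of atoms. For $x<y$ in $L$, $y$ covers $x$ if $[x,y]=\{x,y\}$. $L$ is graded if there is a function $r:L\to\mathbb{R}_{\ge 0}$ (a rank function) with $r(\hat 0)=0$ and $r(y)=r(x)+1$ whenever $y$ covers $x$. A graded lattice is semimodular if $r(x\wedge y)+r(x\vee y)\le r(x)+r(y)$ for all $x,y\in L$. A geometric lattice is a finite, atomistic, semimodular lattice. The Möbius function $\mu:L\times L\to\mathbb{Z}$ is defined recursively by $\mu(x,z)=0$ if $x\not\le z$, $\mu(x,x)=1$ for all $x\in L$, and $\mu(x,z)=-\sum_{x\le y<z}\mu(x,y)$ if $x<z$.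
   Formalization: The second inequality is stated only for geometric lattices with more than one element: for the one-element lattice the sum over r(x) ≤ 2k−1 equals μ(0̂,0̂) = 1 > 0, so the claim fails there; the first inequality is stated for all geometric lattices. *)

theory Defs
  imports Complex_Main "HOL-Algebra.Lattice"
begin

locale finite_partial_order = partial_order L for L (structure) +
  assumes finite_carrier: "finite (carrier L)"
begin

text \<open>Outside \<^term>\<open>carrier L\<close> the function takes the junk value 0.\<close>

function mobius :: "'a \<Rightarrow> 'a \<Rightarrow> int" where
  "mobius x z =
    (if x \<notin> carrier L \<or> z \<notin> carrier L \<or> \<not> x \<sqsubseteq> z then 0
     else if x = z then 1
     else - (\<Sum>y\<in>{y \<in> carrier L. x \<sqsubseteq> y \<and> y \<sqsubset> z}. mobius x y))"
  by pat_completeness auto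

termination
proof (relation "measure (\<lambda>(x, z). card {y \<in> carrier L. y \<sqsubset> z})", goal_cases)
  case 1
  show ?case by simp
next
  case (2 x z y)
  then have z: "z \<in> carrier L" and y: "y \<in> carrier L" and yz: "y \<sqsubset> z"
    by auto
  have "{w \<in> carrier L. w \<sqsubset> y} \<subseteq> {w \<in> carrier L. w \<sqsubset> z}"
    using y z yz by (auto intro: lless_trans)
  moreover have "y \<notin> {w \<in> carrier L. w \<sqsubset> y}"
    using y by (simp add: lless_eq)
  moreover have "y \<in> {w \<in> carrier L. w \<sqsubset> z}"
    using y yz by simp
  ultimately have "{w \<in> carrier L. w \<sqsubset> y} \<subset> {w \<in> carrier L. w \<sqsubset> z}"
    by blast
  then show ?case
    using finite_carrier by (simp add: psubset_card_mono)
qed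

declare mobius.simps [simp del]

lemma mobius_not_le: "\<not> x \<sqsubseteq> z \<Longrightarrow> mobius x z = 0"
  by (simp add: mobius.simps)

lemma mobius_refl: "x \<in> carrier L \<Longrightarrow> mobius x x = 1"
  by (simp add: mobius.simps)

lemma mobius_less:
  assumes "x \<in> carrier L" "z \<in> carrier L" "x \<sqsubset> z"
  shows "mobius x z = - (\<Sum>y\<in>{y \<in> carrier L. x \<sqsubseteq> y \<and> y \<sqsubset> z}. mobius x y)"
  using assms by (subst mobius.simps) (auto simp: lless_eq)

end

definition atom :: "('a, 'b) gorder_scheme \<Rightarrow> 'a \<Rightarrow> bool" where
  "atom L x \<longleftrightarrow> x \<in> carrier L \<and> x \<noteq> \<bottom>\<^bsub>L\<^esub> \<and>
     \<not> (\<exists>y\<in>carrier L. \<bottom>\<^bsub>L\<^esub> \<sqsubset>\<^bsub>L\<^esub> y \<and> y \<sqsubset>\<^bsub>L\<^esub> x)"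

definition atomistic :: "('a, 'b) gorder_scheme \<Rightarrow> bool" where
  "atomistic L \<longleftrightarrow>
     (\<forall>x\<in>carrier L. x \<noteq> \<bottom>\<^bsub>L\<^esub> \<longrightarrow> (\<exists>A\<subseteq>{a. atom L a}. is_lub L x A))"

text \<open>\<open>covers L y x\<close> reads ``\<open>y\<close> covers \<open>x\<close>''.\<close>

definition covers :: "('a, 'b) gorder_scheme \<Rightarrow> 'a \<Rightarrow> 'a \<Rightarrow> bool" where
  "covers L y x \<longleftrightarrow> x \<in> carrier L \<and> y \<in> carrier L \<and>
     x \<sqsubset>\<^bsub>L\<^esub> y \<and> \<lbrace>x..y\<rbrace>\<^bsub>L\<^esub> = {x, y}"

definition rank_function :: "('a, 'b) gorder_scheme \<Rightarrow> ('a \<Rightarrow> real) \<Rightarrow> bool" where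
  "rank_function L r \<longleftrightarrow>
     (\<forall>x\<in>carrier L. 0 \<le> r x) \<and> r \<bottom>\<^bsub>L\<^esub> = 0 \<and>
     (\<forall>x y. covers L y x \<longrightarrow> r y = r x + 1)"

text \<open>On a finite lattice the rank function is unique on the carrier, so asking for some rank
  function with the inequality is the same as asking for it of every rank function.\<close>

definition semimodular :: "('a, 'b) gorder_scheme \<Rightarrow> bool" where
  "semimodular L \<longleftrightarrow>
     (\<exists>r. rank_function L r \<and>
       (\<forall>x\<in>carrier L. \<forall>y\<in>carrier L.
          r (x \<sqinter>\<^bsub>L\<^esub> y) + r (x \<squnion>\<^bsub>L\<^esub> y) \<le> r x + r y))"

text \<open>The locale \<^locale>\<open>lattice\<close> admits an empty carrier, so nonemptiness is required
  explicitly; it guarantees that \<open>\<bottom>\<close> is a genuine least element.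
  The one-element lattice is geometric under this definition; there the sum of the Moebius function
  over the elements of rank at most $n$ is 1 for every $n \<ge> 0$, so the upper bound 0 for odd $n$
  can only hold for carriers other than \<open>{\<bottom>}\<close>.\<close>

locale geometric_lattice = lattice L + finite_partial_order L for L (structure) +
  assumes nonempty: "carrier L \<noteq> {}"
    and atomistic: "atomistic L"
    and semimodular: "semimodular L"

lemma (in geometric_lattice) bottom_least: "least L \<bottom> (carrier L)"
proof -
  have "greatest L (\<Sqinter>(carrier L)) (Lower L (carrier L))"
    by (rule finite_inf_greatest) (use finite_carrier nonempty in auto)
  then have "least L (\<Sqinter>(carrier L)) (carrier L)"
    by (auto simp: least_def greatest_def Lower_def)
  then show ?thesis
    unfolding bottom_def by (rule someI)
qed

end

theory Submission
  imports Defs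
begin

text \<open>
  Fix an atom \<open>a\<close>. Weisner's identity (\<open>sum_mobius_join_fibre\<close>) says that the values
  \<open>\<mu>(\<bottom>, y)\<close> cancel over each fibre of the closure operator \<open>y \<mapsto> y \<squnion> a\<close>. Semimodularity says that
  this operator raises the rank by at most one. These two facts give both ingredients.

  First, the sign of the Moebius function alternates with the rank (\<open>mobius_bottom_sign\<close>): if
  \<open>a \<sqsubseteq> x\<close>, then \<open>\<mu>(\<bottom>, x)\<close> is minus the sum of \<open>\<mu>(\<bottom>, y)\<close> over the other \<open>y\<close> in the fibre of \<open>x\<close>,
  and all of these have rank exactly one less than \<open>x\<close>.

  Secondly, split the sum of \<open>\<mu>(\<bottom>, y)\<close> over the elements of rank at most \<open>j\<close> according to
  \<open>y \<squnion> a\<close>. A fibre over an element of rank at most \<open>j\<close> lies entirely in the range of summation and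
  contributes 0. What is left are those \<open>y\<close> that leave the range when joined with \<open>a\<close>; they all
  have rank exactly \<open>j\<close>, hence all their terms have the sign of \<open>(-1)\<^sup>j\<close>
  (\<open>sum_mobius_rank_le_sign\<close>).
\<close>

section \<open>Finite partial orders\<close>

context finite_partial_order
begin

lemma lless_induct [consumes 1, case_names less]:
  assumes "x \<in> carrier L"
    and step: "\<And>x. x \<in> carrier L \<Longrightarrow> (\<And>y. y \<in> carrier L \<Longrightarrow> y \<sqsubset> x \<Longrightarrow> P y) \<Longrightarrow> P x"
  shows "P x"
  using assms(1)
proof (induction "card {w \<in> carrier L. w \<sqsubset> x}" arbitrary: x rule: less_induct)
  case less
  show ?case
  proof (rule step[OF less.prems])
    fix y assume y: "y \<in> carrier L" "y \<sqsubset> x"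
    have "{w \<in> carrier L. w \<sqsubset> y} \<subset> {w \<in> carrier L. w \<sqsubset> x}"
      using y less.prems by (auto simp: lless_eq intro: le_trans dest: le_antisym)
    then have "card {w \<in> carrier L. w \<sqsubset> y} < card {w \<in> carrier L. w \<sqsubset> x}"
      using finite_carrier by (simp add: psubset_card_mono)
    then show "P y"
      using less.hyps y(1) by blast
  qed
qed

lemma lower_cover_exists:
  assumes "x \<in> carrier L" "y \<in> carrier L" "x \<sqsubset> y"
  obtains z where "covers L y z" "x \<sqsubseteq> z"
proof -
  let ?W = "{w \<in> carrier L. x \<sqsubseteq> w \<and> w \<sqsubset> y}"
  have "\<exists>m\<in>?W. \<forall>w\<in>?W. w \<noteq> m \<longrightarrow> \<not> m \<sqsubset> w"
  proof (rule Finite_Set.bex_max_element)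
    show "finite ?W" using finite_carrier by simp
    show "asymp_on ?W (\<lambda>v w. v \<sqsubset> w)"
      by (rule asymp_onI) (auto simp: lless_eq dest: le_antisym)
    show "transp_on ?W (\<lambda>v w. v \<sqsubset> w)"
      by (rule transp_onI) (auto intro: lless_trans)
    show "?W \<noteq> {}" using assms by auto
  qed
  then obtain m where m: "m \<in> carrier L" "x \<sqsubseteq> m" "m \<sqsubset> y"
    and max: "\<And>w. w \<in> carrier L \<Longrightarrow> x \<sqsubseteq> w \<Longrightarrow> w \<sqsubset> y \<Longrightarrow> \<not> m \<sqsubset> w"
    by (auto simp: lless_eq)
  have "w = m \<or> w = y" if w: "w \<in> carrier L" "m \<sqsubseteq> w" "w \<sqsubseteq> y" for w
    using max[of w] m w assms le_trans[of x m w] by (auto simp: lless_eq)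
  then have "\<lbrace>m..y\<rbrace> = {m, y}"
    using m assms by (auto simp: at_least_at_most_def lless_eq)
  then show thesis
    using that m assms by (auto simp: covers_def)
qed

lemma sum_mobius_interval_eq_0:
  assumes "x \<in> carrier L" "z \<in> carrier L" "x \<sqsubset> z"
  shows "(\<Sum>y\<in>{y \<in> carrier L. y \<sqsubseteq> z}. mobius x y) = 0"
proof -
  have "(\<Sum>y\<in>{y \<in> carrier L. y \<sqsubseteq> z}. mobius x y)
      = (\<Sum>y\<in>insert z {y \<in> carrier L. x \<sqsubseteq> y \<and> y \<sqsubset> z}. mobius x y)"
    by (rule sum.mono_neutral_right)
      (use assms finite_carrier in \<open>auto simp: lless_eq intro: mobius_not_le\<close>)
  also have "\<dots> = 0"
    using assms finite_carrier by (simp add: mobius_less lless_eq)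
  finally show ?thesis .
qed

end

section \<open>Weisner's identity\<close>

locale finite_lattice = lattice L + finite_partial_order L for L (structure)

sublocale geometric_lattice \<subseteq> finite_lattice ..

context finite_lattice
begin

lemma join_le_iff:
  assumes "x \<in> carrier L" "y \<in> carrier L" "z \<in> carrier L"
  shows "x \<squnion> y \<sqsubseteq> z \<longleftrightarrow> x \<sqsubseteq> z \<and> y \<sqsubseteq> z"
  using assms by (meson join_closed join_le join_left join_right le_trans)

text \<open>
  Since \<open>y \<sqsubseteq> x\<close> is equivalent to \<open>y \<squnion> b \<sqsubseteq> x\<close>, the sum of \<open>\<mu>(u, y)\<close> over all \<open>y \<sqsubseteq> x\<close>, which is 0,
  is the sum over all fibres that belong to some \<open>z \<sqsubseteq> x\<close> above \<open>b\<close>. By induction the fibres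
  of the smaller \<open>z\<close> contribute nothing, so the fibre of \<open>x\<close> contributes nothing either.
\<close>

lemma sum_mobius_join_fibre:
  assumes "x \<in> carrier L" "u \<in> carrier L" "b \<in> carrier L" "u \<sqsubset> b" "b \<sqsubseteq> x"
  shows "(\<Sum>y\<in>{y \<in> carrier L. y \<squnion> b = x}. mobius u y) = 0"
  using assms
proof (induction x rule: lless_induct)
  case (less x)
  let ?fibre = "\<lambda>z. \<Sum>y\<in>{y \<in> carrier L. y \<squnion> b = z}. mobius u y"
  let ?S = "{y \<in> carrier L. y \<sqsubseteq> x}" and ?T = "{z \<in> carrier L. b \<sqsubseteq> z \<and> z \<sqsubseteq> x}"
  have "u \<sqsubset> x"
    using less.prems less.hyps le_trans[of u b x] le_antisym[of u b] by (auto simp: lless_eq)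
  then have "0 = (\<Sum>y\<in>?S. mobius u y)"
    using less.hyps less.prems by (simp add: sum_mobius_interval_eq_0)
  also have "\<dots> = (\<Sum>z\<in>?T. \<Sum>y\<in>{y \<in> ?S. y \<squnion> b = z}. mobius u y)"
    by (rule sum.group[symmetric])
      (use finite_carrier less.prems less.hyps in \<open>auto simp: join_le_iff intro: join_right\<close>)
  also have "\<dots> = (\<Sum>z\<in>?T. ?fibre z)"
  proof (rule sum.cong[OF HOL.refl])
    fix z assume "z \<in> ?T"
    then have "{y \<in> ?S. y \<squnion> b = z} = {y \<in> carrier L. y \<squnion> b = z}"
      using less.prems less.hyps by (auto simp: join_le_iff)
    then show "(\<Sum>y\<in>{y \<in> ?S. y \<squnion> b = z}. mobius u y) = ?fibre z"
      by simp
  qed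
  also have "\<dots> = (\<Sum>z\<in>{x}. ?fibre z)"
    by (rule sum.mono_neutral_right)
      (use finite_carrier less.prems less.hyps less.IH in \<open>auto simp: lless_eq\<close>)
  finally show ?case by simp
qed

end

section \<open>Rank functions\<close>

context geometric_lattice
begin

lemma bottom_in_carrier: "\<bottom> \<in> carrier L"
  and bottom_le: "x \<in> carrier L \<Longrightarrow> \<bottom> \<sqsubseteq> x"
  using bottom_least by (auto simp: least_def)

lemma bottom_lless: "x \<in> carrier L \<Longrightarrow> x \<noteq> \<bottom> \<Longrightarrow> \<bottom> \<sqsubset> x"
  using bottom_le[of x] by (auto simp: lless_eq)

lemma atom_below_exists:
  assumes "x \<in> carrier L" "x \<noteq> \<bottom>"
  obtains a where "atom L a" "a \<sqsubseteq> x"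
  using assms
proof (induction x arbitrary: thesis rule: lless_induct)
  case (less x)
  show ?case
  proof (cases "atom L x")
    case True
    then show ?thesis using less.prems less.hyps by auto
  next
    case False
    then obtain y where y: "y \<in> carrier L" "\<bottom> \<sqsubset> y" "y \<sqsubset> x"
      using less.prems less.hyps by (auto simp: atom_def)
    then obtain a where "atom L a" "a \<sqsubseteq> y"
      using less.IH[of y] by (auto simp: lless_eq)
    then show ?thesis
      using less.prems less.hyps y by (meson atom_def le_trans lless_eq)
  qed
qed

lemma atom_covers_bottom: "atom L a \<Longrightarrow> covers L a \<bottom>"
  using bottom_in_carrier bottom_lless
  by (auto simp: atom_def covers_def at_least_at_most_def lless_eq bottom_le)

lemma rank_strict_mono:
  assumes "rank_function L r" "y \<in> carrier L" "x \<in> carrier L" "x \<sqsubset> y"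
  shows "r x < r y"
  using assms(2-)
proof (induction y rule: lless_induct)
  case (less y)
  obtain z where z: "covers L y z" "x \<sqsubseteq> z"
    using lower_cover_exists less.prems less.hyps by blast
  then have "r y = r z + 1" "z \<in> carrier L" "z \<sqsubset> y"
    using assms(1) by (auto simp: rank_function_def covers_def)
  moreover have "r x \<le> r z"
    using less.IH[of z] less.prems z calculation by (cases "x = z") (auto simp: lless_eq)
  ultimately show ?case by simp
qed

lemma rank_mono:
  assumes "rank_function L r" "y \<in> carrier L" "x \<in> carrier L" "x \<sqsubseteq> y"
  shows "r x \<le> r y"
  using rank_strict_mono[OF assms(1-3)] assms(4) by (cases "x = y") (auto simp: lless_eq)

lemma rank_is_nat:
  assumes "rank_function L r" "x \<in> carrier L"
  obtains n where "r x = real n"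
  using assms(2)
proof (induction x arbitrary: thesis rule: lless_induct)
  case (less x)
  show ?case
  proof (cases "x = \<bottom>")
    case True
    then show ?thesis using less.prems(1)[of 0] assms(1) by (simp add: rank_function_def)
  next
    case False
    then obtain z where z: "covers L x z"
      using lower_cover_exists bottom_lless bottom_in_carrier less.hyps by metis
    then obtain n where "r z = real n"
      using less.IH[of z] by (auto simp: covers_def)
    then show ?thesis
      using z less.prems(1)[of "Suc n"] assms(1) by (simp add: rank_function_def)
  qed
qed

text \<open>
  Semimodularity grants its inequality only for some rank function; uniqueness carries it over to
  the given one.
\<close>

lemma rank_unique:
  assumes "rank_function L r" "rank_function L s" "x \<in> carrier L"
  shows "r x = s x"
  using assms(3)
proof (induction x rule: lless_induct)
  case (less x)
  show ?case
  proof (cases "x = \<bottom>")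
    case True
    then show ?thesis using assms(1,2) by (simp add: rank_function_def)
  next
    case False
    then obtain z where z: "covers L x z"
      using lower_cover_exists bottom_lless bottom_in_carrier less.hyps by metis
    then have "r z = s z"
      using less.IH[of z] by (auto simp: covers_def)
    then show ?thesis
      using z assms(1,2) by (simp add: rank_function_def)
  qed
qed

lemma rank_join_atom_le:
  assumes r: "rank_function L r" and a: "atom L a" and y: "y \<in> carrier L"
  shows "r (y \<squnion> a) \<le> r y + 1"
proof -
  obtain s where s: "rank_function L s"
    and semi: "\<And>x y. x \<in> carrier L \<Longrightarrow> y \<in> carrier L \<Longrightarrow> s (x \<sqinter> y) + s (x \<squnion> y) \<le> s x + s y"
    using semimodular by (auto simp: semimodular_def)
  have a': "a \<in> carrier L" using a by (simp add: atom_def)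
  have "s a = 1"
    using s atom_covers_bottom[OF a] by (auto simp: rank_function_def)
  moreover have "0 \<le> s (y \<sqinter> a)"
    using s y a' by (simp add: rank_function_def)
  ultimately have "s (y \<squnion> a) \<le> s y + 1"
    using semi[OF y a'] by simp
  then show ?thesis
    using rank_unique[OF r s] y a' by simp
qed

section \<open>Signs\<close>

text \<open>
  If \<open>x\<close> lies above an atom \<open>a\<close>, Weisner's identity expresses \<open>\<mu>(\<bottom>, x)\<close> as minus the sum of the
  \<open>\<mu>(\<bottom>, y)\<close> with \<open>y \<sqsubset> x\<close> and \<open>y \<squnion> a = x\<close>. Such a \<open>y\<close> has rank one less than \<open>x\<close>, so each step of the
  induction on the rank flips the sign.
\<close>

lemma mobius_bottom_sign:
  assumes r: "rank_function L r" and "x \<in> carrier L" "r x = real n"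
  shows "(-1) ^ n * mobius \<bottom> x \<ge> 0"
  using assms(2-)
proof (induction n arbitrary: x)
  case 0
  have "x = \<bottom>"
    using rank_strict_mono[OF r 0(1) bottom_in_carrier] bottom_lless[OF 0(1)] 0 r
    by (auto simp: rank_function_def)
  then show ?case by (simp add: mobius_refl bottom_in_carrier)
next
  case (Suc n)
  have "x \<noteq> \<bottom>" using Suc.prems r by (auto simp: rank_function_def)
  then obtain a where a: "atom L a" "a \<sqsubseteq> x"
    using atom_below_exists Suc.prems by blast
  then have ac: "a \<in> carrier L" "\<bottom> \<sqsubset> a"
    using bottom_lless by (auto simp: atom_def)
  have xa: "x \<squnion> a = x"
    using a ac Suc.prems join_le_iff[of x a x] join_left[of x a] le_antisym[of "x \<squnion> a" x] by simp
  let ?F = "{y \<in> carrier L. y \<squnion> a = x}"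
  have "mobius \<bottom> x + (\<Sum>y\<in>?F - {x}. mobius \<bottom> y) = (\<Sum>y\<in>?F. mobius \<bottom> y)"
    by (rule sum.remove[symmetric]) (use finite_carrier xa Suc.prems in auto)
  also have "\<dots> = 0"
    using sum_mobius_join_fibre Suc.prems bottom_in_carrier ac a by blast
  finally have "mobius \<bottom> x = - (\<Sum>y\<in>?F - {x}. mobius \<bottom> y)"
    by (simp add: eq_neg_iff_add_eq_0)
  then have "(-1) ^ Suc n * mobius \<bottom> x = (\<Sum>y\<in>?F - {x}. (-1) ^ n * mobius \<bottom> y)"
    by (simp add: sum_distrib_left sum_negf)
  also have "\<dots> \<ge> 0"
  proof (rule sum_nonneg)
    fix y assume "y \<in> ?F - {x}"
    then have y: "y \<in> carrier L" "y \<squnion> a = x" "y \<noteq> x" by auto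
    then have "y \<sqsubset> x" using join_left[of y a] ac by (simp add: lless_eq)
    then have "r y < r x" using rank_strict_mono[OF r] y Suc.prems by blast
    moreover have "r x \<le> r y + 1" using rank_join_atom_le[OF r a(1) y(1)] y by simp
    moreover obtain m where "r y = real m" using rank_is_nat[OF r y(1)] .
    ultimately have "r y = real n" using Suc.prems by simp
    then show "(-1) ^ n * mobius \<bottom> y \<ge> 0" using Suc.IH y by blast
  qed
  finally show ?case .
qed

text \<open>
  A nontrivial lattice has an atom \<open>a\<close>. The fibres of \<open>y \<mapsto> y \<squnion> a\<close> over elements of rank at most \<open>j\<close>
  cancel, and the terms that remain come from elements of rank exactly \<open>j\<close>, because joining with
  \<open>a\<close> pushes their rank beyond \<open>j\<close> but raises it by at most one.
\<close>

lemma sum_mobius_rank_le_sign: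
  assumes r: "rank_function L r" and nontrivial: "carrier L \<noteq> {\<bottom>}"
  shows "(-1) ^ j * (\<Sum>x\<in>{x \<in> carrier L. r x \<le> real j}. mobius \<bottom> x) \<ge> 0"
proof -
  obtain x where "x \<in> carrier L" "x \<noteq> \<bottom>"
    using nontrivial bottom_in_carrier by blast
  then obtain a where a: "atom L a"
    using atom_below_exists by blast
  then have ac: "a \<in> carrier L" "\<bottom> \<sqsubset> a"
    using bottom_lless by (auto simp: atom_def)
  let ?S = "{y \<in> carrier L. r y \<le> real j}"
  (* the part of ?S that is a union of complete fibres *)
  let ?A = "{y \<in> carrier L. r (y \<squnion> a) \<le> real j}"
  let ?T = "{z \<in> carrier L. a \<sqsubseteq> z \<and> r z \<le> real j}"
  have sub: "?A \<subseteq> ?S"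
  proof safe
    fix y assume y: "y \<in> carrier L" "r (y \<squnion> a) \<le> real j"
    then show "r y \<le> real j"
      using rank_mono[OF r, of "y \<squnion> a" y] join_left[of y a] ac by simp
  qed
  have "(\<Sum>y\<in>?A. mobius \<bottom> y) = (\<Sum>z\<in>?T. \<Sum>y\<in>{y \<in> ?A. y \<squnion> a = z}. mobius \<bottom> y)"
    by (rule sum.group[symmetric]) (use finite_carrier ac in \<open>auto intro: join_right\<close>)
  also have "\<dots> = (\<Sum>z\<in>?T. 0)"
  proof (rule sum.cong[OF HOL.refl])
    fix z assume z: "z \<in> ?T"
    then have "{y \<in> ?A. y \<squnion> a = z} = {y \<in> carrier L. y \<squnion> a = z}" by auto
    then show "(\<Sum>y\<in>{y \<in> ?A. y \<squnion> a = z}. mobius \<bottom> y) = 0"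
      using sum_mobius_join_fibre[of z "\<bottom>" a] z ac bottom_in_carrier by simp
  qed
  finally have "(\<Sum>y\<in>?A. mobius \<bottom> y) = 0" by simp
  then have "(-1) ^ j * (\<Sum>y\<in>?S. mobius \<bottom> y) = (\<Sum>y\<in>?S - ?A. (-1) ^ j * mobius \<bottom> y)"
    using sum.subset_diff[OF sub, of "mobius \<bottom>"] finite_carrier
    by (simp add: sum_distrib_left)
  also have "\<dots> \<ge> 0"
  proof (rule sum_nonneg)
    fix y assume "y \<in> ?S - ?A"
    then have y: "y \<in> carrier L" "r y \<le> real j" "r (y \<squnion> a) > real j" by auto
    obtain m where m: "r y = real m" using rank_is_nat[OF r y(1)] .
    obtain n where n: "r (y \<squnion> a) = real n" using rank_is_nat[OF r, of "y \<squnion> a"] y ac by auto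
    have "r y = real j"
      using rank_join_atom_le[OF r a y(1)] y m n by simp
    then show "(-1) ^ j * mobius \<bottom> y \<ge> 0"
      using mobius_bottom_sign[OF r y(1)] by blast
  qed
  finally show ?thesis .
qed

end

theorem theorem1:
  fixes L :: "('a, 'b) gorder_scheme" and r :: "'a \<Rightarrow> real" and k :: nat
  assumes "geometric_lattice L"
    and "rank_function L r"
    and "k > 0"
  shows "(\<Sum>x\<in>{x \<in> carrier L. r x \<le> 2 * real k}.
            finite_partial_order.mobius L \<bottom>\<^bsub>L\<^esub> x) \<ge> 0 \<and>
         (carrier L \<noteq> {\<bottom>\<^bsub>L\<^esub>} \<longrightarrow>
           (\<Sum>x\<in>{x \<in> carrier L. r x \<le> 2 * real k - 1}.
              finite_partial_order.mobius L \<bottom>\<^bsub>L\<^esub> x) \<le> 0)"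
proof -
  interpret geometric_lattice L by fact
  show ?thesis
  proof (cases "carrier L = {\<bottom>\<^bsub>L\<^esub>}")
    case True
    then have "{x \<in> carrier L. r x \<le> 2 * real k} = {\<bottom>\<^bsub>L\<^esub>}"
      using assms(2) by (auto simp: rank_function_def)
    then show ?thesis
      using True by (simp add: mobius_refl bottom_in_carrier)
  next
    case False
    \<comment> \<open>Truncated subtraction on the naturals is exact here because \<open>k > 0\<close>.\<close>
    have "real (2 * k - 1) = 2 * real k - 1"
      using assms(3) by (simp add: of_nat_diff)
    moreover have "odd (2 * k - 1)"
      using assms(3) by simp
    ultimately show ?thesis
      using sum_mobius_rank_le_sign[OF assms(2) False, of "2 * k"]
        sum_mobius_rank_le_sign[OF assms(2) False, of "2 * k - 1"]
      by simp
  qed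
qed

end
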